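(* Let $f\colon M\to N$ be a continuous map of topological spaces. If the commutative square of topological spaces and continuous maps $$\begin{array}{ccc}\widetilde{M} & \longrightarrow & M\\ {\scriptstyle \widetilde{f}}\downarrow & & \downarrow{\scriptstyle f}\\ \widetilde{N} & \longrightarrow & N\end{array}$$ is a pullback, then $\mathrm{IC}(\widetilde{f})\leq \mathrm{IC}(f)$.
   Context: "Space" means topological space and "map" means continuous map. For a map $f\colon X\to Y$, the injective category number $\mathrm{IC}(f)$ is the smallest positive integer $\ell$ such that there are open subsets $U_1,\ldots,U_\ell\subset X$ with $X=U_1\cup\cdots\cup U_\ell$ and each restriction $f_{|U_j}\colon U_j\to Y$ injective; $\mathrm{IC}(f)=\infty$ if no such $\ell$ exists. Pullback means pullback in the category of topological spaces. *)

theory Defs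
  imports "HOL-Analysis.Product_Topology" "HOL-Library.Extended_Nat"
begin

definition injective_open_cover :: "'a topology \<Rightarrow> ('a \<Rightarrow> 'b) \<Rightarrow> nat \<Rightarrow> bool" where
  "injective_open_cover X f l \<longleftrightarrow>
     (\<exists>U :: nat \<Rightarrow> 'a set. (\<forall>j\<in>{1..l}. openin X (U j) \<and> inj_on f (U j)) \<and>
        topspace X = (\<Union>j\<in>{1..l}. U j))"

text \<open>The codomain of a map does not enter the definition. As \<open>l\<close> has to be positive, the map
  from the empty space has injective category number 1.\<close>

definition IC :: "'a topology \<Rightarrow> ('a \<Rightarrow> 'b) \<Rightarrow> enat" where
  "IC X f = (if \<exists>l\<ge>1. injective_open_cover X f l
             then enat (LEAST l. 1 \<le> l \<and> injective_open_cover X f l) else \<infinity>)"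

text \<open>Squares with top map \<open>p : P \<rightarrow> X\<close>, left map \<open>q : P \<rightarrow> Y\<close>, right map \<open>f : X \<rightarrow> Z\<close> and bottom
  map \<open>g : Y \<rightarrow> Z\<close>. Maps are total functions that matter only on the carriers.\<close>

definition commutative_square ::
  "'p topology \<Rightarrow> 'x topology \<Rightarrow> 'y topology \<Rightarrow> 'z topology \<Rightarrow>
   ('p \<Rightarrow> 'x) \<Rightarrow> ('p \<Rightarrow> 'y) \<Rightarrow> ('x \<Rightarrow> 'z) \<Rightarrow> ('y \<Rightarrow> 'z) \<Rightarrow> bool" where
  "commutative_square P X Y Z p q f g \<longleftrightarrow>
     continuous_map P X p \<and> continuous_map P Y q \<and>
     continuous_map X Z f \<and> continuous_map Y Z g \<and>
     (\<forall>w\<in>topspace P. f (p w) = g (q w))"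

definition mediating_map ::
  "'t topology \<Rightarrow> 'p topology \<Rightarrow> ('p \<Rightarrow> 'x) \<Rightarrow> ('p \<Rightarrow> 'y) \<Rightarrow> ('t \<Rightarrow> 'x) \<Rightarrow> ('t \<Rightarrow> 'y) \<Rightarrow>
   ('t \<Rightarrow> 'p) \<Rightarrow> bool" where
  "mediating_map T P p q a b u \<longleftrightarrow>
     continuous_map T P u \<and> (\<forall>t\<in>topspace T. p (u t) = a t \<and> q (u t) = b t)"

text \<open>The universal property, tested on all spaces with points in the type \<open>'t\<close>.\<close>

definition pullback_on ::
  "'t itself \<Rightarrow> 'p topology \<Rightarrow> 'x topology \<Rightarrow> 'y topology \<Rightarrow> 'z topology \<Rightarrow>
   ('p \<Rightarrow> 'x) \<Rightarrow> ('p \<Rightarrow> 'y) \<Rightarrow> ('x \<Rightarrow> 'z) \<Rightarrow> ('y \<Rightarrow> 'z) \<Rightarrow> bool" where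
  "pullback_on _ P X Y Z p q f g \<longleftrightarrow>
     commutative_square P X Y Z p q f g \<and>
     (\<forall>(T :: 't topology) a b. commutative_square T X Y Z a b f g \<longrightarrow>
        (\<exists>u. mediating_map T P p q a b u \<and>
           (\<forall>v. mediating_map T P p q a b v \<longrightarrow> (\<forall>t\<in>topspace T. v t = u t))))"

text \<open>A formula cannot quantify over the type of the test spaces. The type \<open>'x \<times> 'y\<close>, which
  contains the points of the fibre product, is large enough: by \<open>is_pullback_universal\<close> below,
  the universal property then holds for test spaces over every type.\<close>

definition is_pullback ::
  "'p topology \<Rightarrow> 'x topology \<Rightarrow> 'y topology \<Rightarrow> 'z topology \<Rightarrow>
   ('p \<Rightarrow> 'x) \<Rightarrow> ('p \<Rightarrow> 'y) \<Rightarrow> ('x \<Rightarrow> 'z) \<Rightarrow> ('y \<Rightarrow> 'z) \<Rightarrow> bool" where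
  "is_pullback P X Y Z p q f g \<longleftrightarrow> pullback_on TYPE('x \<times> 'y) P X Y Z p q f g"

lemma is_pullback_universal:
  fixes P :: "'p topology" and X :: "'x topology" and Y :: "'y topology" and Z :: "'z topology"
  assumes pb: "is_pullback P X Y Z p q f g"
  shows "pullback_on TYPE('t) P X Y Z p q f g"
proof -
  have sq: "commutative_square P X Y Z p q f g"
    and univ: "\<And>(T :: ('x \<times> 'y) topology) a b. commutative_square T X Y Z a b f g \<Longrightarrow>
        \<exists>u. mediating_map T P p q a b u \<and>
           (\<forall>v. mediating_map T P p q a b v \<longrightarrow> (\<forall>t\<in>topspace T. v t = u t))"
    using pb unfolding is_pullback_def pullback_on_def by blast+
  have inj: "w = w'"
    if w: "w \<in> topspace P" "w' \<in> topspace P" "p w = p w'" "q w = q w'" for w w'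
  proof -
    define T where "T = discrete_topology {(p w, q w)}"
    have T: "topspace T = {(p w, q w)}" by (simp add: T_def)
    have "commutative_square T X Y Z (\<lambda>_. p w) (\<lambda>_. q w) f g"
      using sq w unfolding commutative_square_def T_def
      by (auto simp: continuous_map_def)
    from univ[OF this] obtain u where
      u: "\<And>v. mediating_map T P p q (\<lambda>_. p w) (\<lambda>_. q w) v \<Longrightarrow> \<forall>t\<in>topspace T. v t = u t"
      by blast
    have "mediating_map T P p q (\<lambda>_. p w) (\<lambda>_. q w) (\<lambda>_. w)"
         "mediating_map T P p q (\<lambda>_. p w) (\<lambda>_. q w) (\<lambda>_. w')"
      using w unfolding mediating_map_def by auto
    from u[OF this(1)] u[OF this(2)] show ?thesis by (simp add: T)
  qed
  define F where "F = subtopology (prod_topology X Y) {z. f (fst z) = g (snd z)}"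
  have "commutative_square F X Y Z fst snd f g"
    using sq unfolding commutative_square_def F_def
    by (auto intro!: continuous_map_from_subtopology continuous_map_fst continuous_map_snd)
  from univ[OF this] obtain u where u: "mediating_map F P p q fst snd u" by blast
  have "\<exists>k. mediating_map T P p q a b k \<and>
           (\<forall>v. mediating_map T P p q a b v \<longrightarrow> (\<forall>t\<in>topspace T. v t = k t))"
    if T: "commutative_square T X Y Z a b f g" for T :: "'t topology" and a b
  proof -
    have c: "continuous_map T F (\<lambda>t. (a t, b t))"
      using T unfolding commutative_square_def F_def
      by (auto simp: continuous_map_in_subtopology continuous_map_pairedI)
    have m: "mediating_map T P p q a b (u \<circ> (\<lambda>t. (a t, b t)))"
      using u c continuous_map_image_subset_topspace[OF c]
      unfolding mediating_map_def by (auto intro!: continuous_map_compose[OF c])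
    have "v t = (u \<circ> (\<lambda>t. (a t, b t))) t"
      if v: "mediating_map T P p q a b v" and t: "t \<in> topspace T" for v t
    proof (rule inj)
      show "v t \<in> topspace P" "(u \<circ> (\<lambda>t. (a t, b t))) t \<in> topspace P"
        using v m t continuous_map_image_subset_topspace unfolding mediating_map_def by blast+
      show "p (v t) = p ((u \<circ> (\<lambda>t. (a t, b t))) t)" "q (v t) = q ((u \<circ> (\<lambda>t. (a t, b t))) t)"
        using v m t unfolding mediating_map_def by auto
    qed
    with m show ?thesis by blast
  qed
  with sq show ?thesis unfolding pullback_on_def by blast
qed

lemma is_pullback_fibre_product:
  assumes "continuous_map X Z f" "continuous_map Y Z g"
  shows "is_pullback (subtopology (prod_topology X Y) {z. f (fst z) = g (snd z)}) X Y Z fst snd f g"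
    (is "is_pullback ?F _ _ _ _ _ _ _")
proof -
  have "commutative_square ?F X Y Z fst snd f g"
    using assms unfolding commutative_square_def
    by (auto intro!: continuous_map_from_subtopology continuous_map_fst continuous_map_snd)
  moreover have "mediating_map T ?F fst snd a b (\<lambda>t. (a t, b t))"
    if "commutative_square T X Y Z a b f g" for T :: "('a \<times> 'c) topology" and a b
    using that unfolding commutative_square_def mediating_map_def
    by (auto simp: continuous_map_in_subtopology continuous_map_pairedI)
  moreover have "v t = (a t, b t)"
    if "mediating_map T ?F fst snd a b v" "t \<in> topspace T" for T :: "('a \<times> 'c) topology" and a b v t
    using that unfolding mediating_map_def by (auto simp: prod_eq_iff)
  ultimately show ?thesis unfolding is_pullback_def pullback_on_def by blast
qed

end

theory Submission
  imports Defs
begin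

text \<open>A point of a pullback is determined by its two projections. Over an open set \<open>U\<close> on which
  \<open>f\<close> is injective, the commutativity of the square makes the projection to \<open>M\<close> a function of the
  projection to \<open>N'\<close>; hence \<open>f'\<close> is injective on the preimage of \<open>U\<close>, and the preimages of an
  open cover of \<open>M\<close> form an open cover of \<open>M'\<close>.\<close>

text \<open>Points of \<open>P\<close> are maps from the one-point space, so the uniqueness half of
  the universal property identifies \<open>w\<close> with \<open>w'\<close>.\<close>

lemma pullback_point_eqI:
  assumes pb: "is_pullback P X Y Z p q f g"
    and w: "w \<in> topspace P" "w' \<in> topspace P" "p w = p w'" "q w = q w'"
  shows "w = w'"
proof -
  define T where "T = discrete_topology {()}"
  \<comment> \<open>\<open>is_pullback\<close> tests only spaces over the product type;
    \<open>is_pullback_universal\<close> moves the property to \<open>unit\<close>.\<close>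
  have pb': "pullback_on TYPE(unit) P X Y Z p q f g"
    using pb by (rule is_pullback_universal)
  then have "commutative_square T X Y Z (\<lambda>_. p w) (\<lambda>_. q w) f g"
    using w unfolding pullback_on_def commutative_square_def T_def
    by (auto simp: continuous_map_def)
  with pb' obtain u where
    u: "\<And>v. mediating_map T P p q (\<lambda>_. p w) (\<lambda>_. q w) v \<Longrightarrow> \<forall>t\<in>topspace T. v t = u t"
    unfolding pullback_on_def by blast
  have "mediating_map T P p q (\<lambda>_. p w) (\<lambda>_. q w) (\<lambda>_. w)"
    and "mediating_map T P p q (\<lambda>_. p w) (\<lambda>_. q w) (\<lambda>_. w')"
    using w unfolding mediating_map_def by auto
  from u[OF this(1)] u[OF this(2)] show ?thesis by (simp add: T_def)
qed

lemma injective_open_cover_pullback: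
  assumes pb: "is_pullback P X Y Z p q f g" and cover: "injective_open_cover X f l"
  shows "injective_open_cover P q l"
proof -
  have p: "continuous_map P X p" and comm: "\<And>w. w \<in> topspace P \<Longrightarrow> f (p w) = g (q w)"
    using pb unfolding is_pullback_def pullback_on_def commutative_square_def by auto
  obtain U where U: "\<And>j. j \<in> {1..l} \<Longrightarrow> openin X (U j) \<and> inj_on f (U j)"
    and X: "topspace X = (\<Union>j\<in>{1..l}. U j)"
    using cover unfolding injective_open_cover_def by blast
  \<comment> \<open>Some \<open>V j\<close> may be empty or coincide; as an indexed family they
    still form a cover with the same \<open>l\<close>.\<close>
  define V where "V j = {w \<in> topspace P. p w \<in> U j}" for j
  have "openin P (V j)" if "j \<in> {1..l}" for j
    unfolding V_def using p U[OF that] by (blast intro: openin_continuous_map_preimage)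
  moreover have "inj_on q (V j)" if "j \<in> {1..l}" for j
  proof (rule inj_onI)
    fix w w' assume w: "w \<in> V j" "w' \<in> V j" "q w = q w'"
    then have "f (p w) = f (p w')"
      using comm by (simp add: V_def)
    then have "p w = p w'"
      using U[OF that] w by (auto simp: V_def dest: inj_onD)
    with w show "w = w'"
      using pullback_point_eqI[OF pb] by (simp add: V_def)
  qed
  \<comment> \<open>\<open>p\<close> sends each point of \<open>P\<close> into
    \<open>topspace X\<close>, hence into some \<open>U j\<close>.\<close>
  moreover have "topspace P = (\<Union>j\<in>{1..l}. V j)"
    using continuous_map_image_subset_topspace[OF p] X by (auto simp: V_def)
  ultimately show ?thesis
    unfolding injective_open_cover_def by blast
qed

lemma IC_le:
  assumes "1 \<le> l" "injective_open_cover X f l"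
  shows "IC X f \<le> enat l"
  using assms by (auto simp: IC_def intro: Least_le)

text \<open>A finite value is the least element of a nonempty set of naturals, so it belongs to that
  set.\<close>

lemma IC_attained:
  assumes "IC X f \<noteq> \<infinity>"
  obtains l where "1 \<le> l" "injective_open_cover X f l" "IC X f = enat l"
proof -
  let ?Q = "\<lambda>l. 1 \<le> l \<and> injective_open_cover X f l"
  have "\<exists>l. ?Q l" and eq: "IC X f = enat (Least ?Q)"
    using assms unfolding IC_def by (auto split: if_splits)
  from this(1) have "?Q (Least ?Q)" by (rule LeastI_ex)
  with eq show thesis using that by blast
qed

theorem theorem2p7:
  fixes M :: "'m topology" and N :: "'n topology"
    and M' :: "'m1 topology" and N' :: "'n1 topology"
    and f :: "'m \<Rightarrow> 'n" and f' :: "'m1 \<Rightarrow> 'n1"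
    and g :: "'m1 \<Rightarrow> 'm" and h :: "'n1 \<Rightarrow> 'n"
  assumes "continuous_map M N f"
    and "is_pullback M' M N' N g f' f h"
  shows "IC M' f' \<le> IC M f"
proof (cases "IC M f = \<infinity>")
  case False
  then obtain l where l: "1 \<le> l" "injective_open_cover M f l" "IC M f = enat l"
    by (rule IC_attained)
  \<comment> \<open>The minimal \<open>l\<close> for \<open>f\<close> is admissible for
    \<open>f'\<close>, so it bounds the minimum for \<open>f'\<close>.\<close>
  from assms(2) l(2) have "injective_open_cover M' f' l"
    by (rule injective_open_cover_pullback)
  with l show ?thesis by (simp add: IC_le)
qed simp

end
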